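(* Let $n\ge1$ and $D\ge 1$ be integers, $0\le p<1$, $q=1-p$, let $J=\langle x_1^{D+1},\ldots,x_n^{D+1}\rangle\subset S=\mathbb{k}[x_1,\ldots,x_n]$, and let $I\sim\mathcal{I}(n,D,p)$ be an Erdős--Rényi random monomial ideal in $S$. For every integer $d\ge 0$, the expectation of $h_d=\dim_{\mathbb{k}}[S/(I+J)]_d$ is $$\mathbb{E}[h_d]=q^{-1}\cdot\sum_{x^a\in[S]_d\setminus J} q^{(a_1+1)\cdots(a_n+1)-\sum_{j=D+1}^{|a|}h_{B_a}(j)},$$ where the sum is over all monomials $x^a=x_1^{a_1}\cdots x_n^{a_n}$ of degree $d$ not in $J$, and $h_{B_a}$ is the Hilbert function of $B_a=S/\langle x_1^{a_1+1},\ldots,x_n^{a_n+1}\rangle$.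
   Context: $\mathbb{k}$ is an infinite field and $S$ has the standard grading $\deg x_i=1$. The distribution $\mathcal{I}(n,D,p)$: form a random set $B$ of monomials by including, independently and each with probability $p$, every non-constant monomial in $x_1,\ldots,x_n$ of total degree at most $D$; then $I=\langle B\rangle$, with $I=\langle 0\rangle$ if $B=\emptyset$. For $a=(a_1,\ldots,a_n)\in\mathbb{N}_0^n$, $|a|=a_1+\cdots+a_n$. The Hilbert function of a graded algebra $C$ is $h_C(j)=\dim_{\mathbb{k}}[C]_j$. A sum $\sum_{j=a}^{e}f(j)$ with $a>e$ is zero. *)

theory Defs
  imports
    "HOL-Probability.Probability"
    "HOL-Probability.Product_PMF"
    "HOL-Library.Poly_Mapping"
    "HOL-Algebra.Algebraic_Closure_Type"
    "HOL-Algebra.Embedded_Algebras"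
    "HOL-Algebra.QuotRing"
begin

text \<open>
  The index type \<^typ>\<open>'n::finite\<close> names the variables, so \<open>n = CARD('n) \<ge> 1\<close>, and the type
  \<open>('n, 'k) mpoly\<close> is the whole of \<open>k[x\<^sub>1,\<dots>,x\<^sub>n]\<close>: finitely supported coefficient functions on
  exponent vectors, with the convolution product of \<^theory>\<open>HOL-Library.Poly_Mapping\<close>.
\<close>

type_synonym ('n, 'k) mpoly = "('n \<Rightarrow>\<^sub>0 nat) \<Rightarrow>\<^sub>0 'k"

abbreviation mpoly_ring :: "('n::finite, 'k::field) mpoly ring"
  where "mpoly_ring \<equiv> ring_of_type_algebra"

definition tdeg :: "('n::finite \<Rightarrow>\<^sub>0 nat) \<Rightarrow> nat"
  where "tdeg a = (\<Sum>i\<in>UNIV. Poly_Mapping.lookup a i)"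

definition monomial :: "('n::finite \<Rightarrow>\<^sub>0 nat) \<Rightarrow> ('n, 'k::field) mpoly"
  where "monomial a = Poly_Mapping.single a 1"

definition homogeneous_part :: "nat \<Rightarrow> ('n::finite, 'k::field) mpoly set"
  where "homogeneous_part d = {f. \<forall>a\<in>Poly_Mapping.keys f. tdeg a = d}"

definition constants :: "('n::finite, 'k::field) mpoly set"
  where "constants = (\<lambda>c. Poly_Mapping.single 0 c) ` UNIV"

text \<open>
  The Hilbert function of \<open>S/K\<close>, for a proper homogeneous ideal \<open>K\<close> of \<open>S\<close>.  The degree \<open>d\<close> part
  of \<open>S/K\<close> is the image of the degree \<open>d\<close> part of \<open>S\<close>; the ground field sits in \<open>S/K\<close> as the
  image of the constants, which is a subfield because \<open>K\<close> is proper.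
\<close>

definition hilbert_function :: "('n::finite, 'k::field) mpoly set \<Rightarrow> nat \<Rightarrow> nat"
  where "hilbert_function K d =
    ring.dim (mpoly_ring Quot K)
      ((\<lambda>f. K +>\<^bsub>mpoly_ring\<^esub> f) ` constants)
      ((\<lambda>f. K +>\<^bsub>mpoly_ring\<^esub> f) ` homogeneous_part d)"

definition pure_power_ideal :: "('n::finite \<Rightarrow> nat) \<Rightarrow> ('n, 'k::field) mpoly set"
  where "pure_power_ideal e =
    Idl\<^bsub>mpoly_ring\<^esub> (range (\<lambda>i. monomial (Poly_Mapping.single i (e i))))"

definition random_subset_pmf :: "'a set \<Rightarrow> real \<Rightarrow> 'a set pmf"
  where "random_subset_pmf A p =
    map_pmf (\<lambda>included. {x \<in> A. included x}) (Pi_pmf A False (\<lambda>_. bernoulli_pmf p))"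

text \<open>
  The distribution \<open>\<I>(n, D, p)\<close>.  If the random set of generators is empty, the generated
  ideal is the zero ideal.
\<close>

definition ER_monomial_ideal_pmf ::
    "nat \<Rightarrow> real \<Rightarrow> ('n::finite, 'k::field) mpoly set pmf"
  where "ER_monomial_ideal_pmf D p =
    map_pmf (\<lambda>B. Idl\<^bsub>mpoly_ring\<^esub> B)
      (random_subset_pmf (monomial ` {a. a \<noteq> 0 \<and> tdeg a \<le> D}) p)"

end

theory Submission
  imports Defs
begin

text \<open>
  For an ideal \<open>K\<close> generated by monomials, membership is decided monomial by monomial: \<open>f \<in> K\<close>
  iff every monomial of \<open>f\<close> is divisible by a generator (\<open>genideal_monomials\<close>).  Hence the
  monomials of degree \<open>d\<close> outside \<open>K\<close> form a basis of the degree \<open>d\<close> part of \<open>S/K\<close>, and the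
  Hilbert function counts them (\<open>hilbert_function_genideal_monomials\<close>).

  The ideal \<open>I + J\<close> is again generated by monomials, so \<open>h\<^sub>d\<close> is the number of \<open>x\<^sup>a\<close> of degree \<open>d\<close>
  outside \<open>J\<close> that no element of \<open>B\<close> divides.  By linearity of expectation, \<open>\<bbbE>[h\<^sub>d]\<close> is the sum
  over the \<open>x\<^sup>a\<close> of degree \<open>d\<close> outside \<open>J\<close> of the probability that none of the divisors of \<open>x\<^sup>a\<close>
  was chosen, and by independence this probability is \<open>q\<close> to the number of nonconstant divisors of
  degree at most \<open>D\<close> (\<open>prob_Pi_bernoulli_avoids\<close>).

  That exponent is obtained by counting all divisors of \<open>x\<^sup>a\<close>, of which there are
  \<open>(a\<^sub>1 + 1) \<cdots> (a\<^sub>n + 1)\<close>, and removing the constant one, which gives the factor \<open>q\<^sup>-\<^sup>1\<close>, and those of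
  degree above \<open>D\<close> (\<open>card_generators_dividing\<close>).  The divisors of \<open>x\<^sup>a\<close> of degree \<open>j\<close> are exactly
  the monomials of degree \<open>j\<close> outside \<open>\<langle>x\<^sub>1^(a\<^sub>1+1), \<dots>, x\<^sub>n^(a\<^sub>n+1)\<rangle>\<close>, so they are counted
  by the Hilbert function of \<open>B\<^sub>a\<close>.
\<close>

section \<open>Monomial ideals\<close>

lemma mpoly_ring_simps [simp]:
  "carrier (mpoly_ring :: ('n::finite, 'k::field) mpoly ring) = UNIV"
  "\<zero>\<^bsub>mpoly_ring :: ('n, 'k) mpoly ring\<^esub> = 0"
  "\<one>\<^bsub>mpoly_ring :: ('n, 'k) mpoly ring\<^esub> = 1"
  "f \<oplus>\<^bsub>mpoly_ring :: ('n, 'k) mpoly ring\<^esub> g = f + g"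
  "f \<otimes>\<^bsub>mpoly_ring :: ('n, 'k) mpoly ring\<^esub> g = f * g"
  by (simp_all add: ring_of_type_algebra_def)

lemma cring_mpoly_ring: "cring (mpoly_ring :: ('n::finite, 'k::field) mpoly ring)"
  by (rule cring_from_type_algebra)

lemma ring_mpoly_ring: "ring (mpoly_ring :: ('n::finite, 'k::field) mpoly ring)"
  by (rule ring_from_type_algebra)

lemma mpoly_ring_a_inv [simp]:
  "\<ominus>\<^bsub>mpoly_ring :: ('n::finite, 'k::field) mpoly ring\<^esub> f = - f"
proof -
  interpret ring "mpoly_ring :: ('n, 'k) mpoly ring"
    by (rule ring_mpoly_ring)
  show ?thesis
    using minus_equality[of "- f" f] by simp
qed

lemma mpoly_ring_a_minus [simp]:
  "f \<ominus>\<^bsub>mpoly_ring :: ('n::finite, 'k::field) mpoly ring\<^esub> g = f - g"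
  by (simp add: a_minus_def)

text \<open>
  Divisibility of monomials, read off the exponents.  The order that the type of exponent vectors
  itself carries is lexicographic, so it is not this one.
\<close>

definition exp_le :: "('n::finite \<Rightarrow>\<^sub>0 nat) \<Rightarrow> ('n \<Rightarrow>\<^sub>0 nat) \<Rightarrow> bool"
  where "exp_le b a \<longleftrightarrow> (\<forall>i. Poly_Mapping.lookup b i \<le> Poly_Mapping.lookup a i)"

definition exp_multiples :: "('n::finite \<Rightarrow>\<^sub>0 nat) set \<Rightarrow> ('n \<Rightarrow>\<^sub>0 nat) set"
  where "exp_multiples A = {a. \<exists>b\<in>A. exp_le b a}"

definition monomial_span :: "('n::finite \<Rightarrow>\<^sub>0 nat) set \<Rightarrow> ('n, 'k::field) mpoly set"
  where "monomial_span U = {f. Poly_Mapping.keys f \<subseteq> U}"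

lemma exp_le_diff_add: "exp_le b a \<Longrightarrow> a = (a - b) + b"
  by (rule poly_mapping_eqI) (simp add: exp_le_def lookup_add lookup_minus)

lemma exp_multiples_add: "a \<in> exp_multiples A \<Longrightarrow> c + a \<in> exp_multiples A"
  by (fastforce simp: exp_multiples_def exp_le_def lookup_add intro: trans_le_add2)

lemma monomial_in_span_iff [simp]:
  "(monomial a :: ('n::finite, 'k::field) mpoly) \<in> monomial_span U \<longleftrightarrow> a \<in> U"
  by (simp add: monomial_span_def monomial_def)

text \<open>
  This splits off one coordinate, which is the induction step in all arguments that build a
  polynomial from its monomials.
\<close>

lemma monomial_span_insert_iff:
  fixes f :: "('n::finite, 'k::field) mpoly"
  shows "f \<in> monomial_span (insert a A) \<longleftrightarrow>
    (\<exists>c. \<exists>g\<in>monomial_span A. f = Poly_Mapping.single a c + g)"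
proof
  assume f: "f \<in> monomial_span (insert a A)"
  have "f - Poly_Mapping.single a (Poly_Mapping.lookup f a) \<in> monomial_span A"
    using f by (auto simp: monomial_span_def in_keys_iff lookup_minus lookup_single when_def
        split: if_splits)
  then show "\<exists>c. \<exists>g\<in>monomial_span A. f = Poly_Mapping.single a c + g"
    by (metis add.commute diff_add_cancel)
next
  assume "\<exists>c. \<exists>g\<in>monomial_span A. f = Poly_Mapping.single a c + g"
  then show "f \<in> monomial_span (insert a A)"
    by (auto simp: monomial_span_def in_keys_iff lookup_add lookup_single when_def
        split: if_splits)
qed

lemma single_eq_const_times_monomial:
  "Poly_Mapping.single a c = Poly_Mapping.single 0 c * (monomial a :: ('n::finite, 'k::field) mpoly)"
  by (simp add: monomial_def mult_single)

lemma ideal_monomial_span: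
  "ideal (monomial_span (exp_multiples A) :: ('n::finite, 'k::field) mpoly set) mpoly_ring"
proof (rule idealI[OF ring_mpoly_ring])
  interpret ring "mpoly_ring :: ('n, 'k) mpoly ring"
    by (rule ring_mpoly_ring)
  show "subgroup (monomial_span (exp_multiples A)) (add_monoid (mpoly_ring :: ('n, 'k) mpoly ring))"
  proof (rule add.subgroupI)
    show "monomial_span (exp_multiples A) \<noteq> ({} :: ('n, 'k) mpoly set)"
      by (auto simp: monomial_span_def intro!: exI[of _ 0])
  next
    fix f g :: "('n, 'k) mpoly"
    assume "f \<in> monomial_span (exp_multiples A)" "g \<in> monomial_span (exp_multiples A)"
    then show "f \<oplus>\<^bsub>mpoly_ring\<^esub> g \<in> monomial_span (exp_multiples A)"
      using keys_add[of f g] by (auto simp: monomial_span_def)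
  qed (auto simp: monomial_span_def in_keys_iff)
  show mult: "g \<otimes>\<^bsub>mpoly_ring\<^esub> f \<in> monomial_span (exp_multiples A)"
    if "f \<in> monomial_span (exp_multiples A)" for f g :: "('n, 'k) mpoly"
    using that keys_mult[of g f] by (fastforce simp: monomial_span_def intro: exp_multiples_add)
  show "f \<otimes>\<^bsub>mpoly_ring\<^esub> g \<in> monomial_span (exp_multiples A)"
    if "f \<in> monomial_span (exp_multiples A)" for f g :: "('n, 'k) mpoly"
    using mult[OF that, of g] by (simp add: mult.commute)
qed

text \<open>
  The right-hand side is an ideal because multiples of multiples are multiples.  Conversely every
  term \<open>c x\<^sup>a\<close> with \<open>x\<^sup>b\<close> dividing \<open>x\<^sup>a\<close> is \<open>c x\<^sup>a\<^sup>-\<^sup>b\<close> times the generator \<open>x\<^sup>b\<close>, and a polynomial is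
  the sum of its terms.
\<close>

theorem genideal_monomials:
  "Idl\<^bsub>mpoly_ring\<^esub> (monomial ` A :: ('n::finite, 'k::field) mpoly set) =
    monomial_span (exp_multiples A)"
proof
  interpret ring "mpoly_ring :: ('n, 'k) mpoly ring"
    by (rule ring_mpoly_ring)
  let ?I = "Idl\<^bsub>mpoly_ring\<^esub> (monomial ` A :: ('n, 'k) mpoly set)"
  show "?I \<subseteq> monomial_span (exp_multiples A)"
    by (intro genideal_minimal ideal_monomial_span) (auto simp: exp_multiples_def exp_le_def)
  interpret I: ideal ?I "mpoly_ring :: ('n, 'k) mpoly ring"
    by (rule genideal_ideal) simp
  have single: "Poly_Mapping.single a c \<in> ?I" if a: "a \<in> exp_multiples A" for a c
  proof -
    obtain b where b: "b \<in> A" "exp_le b a"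
      using a by (auto simp: exp_multiples_def)
    have "monomial b \<in> ?I"
      using genideal_self[of "monomial ` A"] b(1) by auto
    then have "Poly_Mapping.single (a - b) c * monomial b \<in> ?I"
      using I.I_l_closed by simp
    then show ?thesis
      using exp_le_diff_add[OF b(2)] by (simp add: monomial_def mult_single)
  qed
  have "monomial_span F \<subseteq> ?I" if "finite F" "F \<subseteq> exp_multiples A" for F
    using that
  proof (induction F)
    case empty
    then show ?case
      using I.zero_closed by (simp add: monomial_span_def)
  next
    case (insert a F)
    show ?case
    proof
      fix f :: "('n, 'k) mpoly"
      assume "f \<in> monomial_span (insert a F)"
      then obtain c g where f: "g \<in> monomial_span F" "f = Poly_Mapping.single a c + g"
        unfolding monomial_span_insert_iff by blast
      have "Poly_Mapping.single a c \<in> ?I"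
        using insert.prems by (intro single) simp
      moreover have "g \<in> ?I"
        using insert f(1) by auto
      ultimately show "f \<in> ?I"
        using I.a_closed[of "Poly_Mapping.single a c" g] f(2) by simp
    qed
  qed
  from this[OF finite_keys] show "monomial_span (exp_multiples A) \<subseteq> ?I"
    by (auto simp: monomial_span_def)
qed

lemma sum_genideal_monomials:
  "Idl\<^bsub>mpoly_ring\<^esub> (monomial ` A) <+>\<^bsub>mpoly_ring\<^esub> Idl\<^bsub>mpoly_ring\<^esub> (monomial ` B) =
    Idl\<^bsub>mpoly_ring\<^esub> (monomial ` (A \<union> B) :: ('n::finite, 'k::field) mpoly set)"
proof -
  interpret ring "mpoly_ring :: ('n, 'k) mpoly ring"
    by (rule ring_mpoly_ring)
  let ?I = "\<lambda>A. Idl\<^bsub>mpoly_ring\<^esub> (monomial ` A :: ('n, 'k) mpoly set)"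
  have ideal: "ideal (?I A) mpoly_ring" for A
    by (rule genideal_ideal) simp
  have self: "monomial ` A \<subseteq> ?I A" for A
    by (rule genideal_self) simp
  have mono: "?I A \<subseteq> ?I (A \<union> B)" "?I B \<subseteq> ?I (A \<union> B)"
    using self[of "A \<union> B"] by (intro genideal_minimal[OF ideal]; simp add: image_Un)+
  have "Idl\<^bsub>mpoly_ring\<^esub> (?I A \<union> ?I B) = ?I (A \<union> B)"
  proof
    show "Idl\<^bsub>mpoly_ring\<^esub> (?I A \<union> ?I B) \<subseteq> ?I (A \<union> B)"
      using mono by (intro genideal_minimal[OF ideal]) auto
    have "ideal (Idl\<^bsub>mpoly_ring\<^esub> (?I A \<union> ?I B)) mpoly_ring"
      by (rule genideal_ideal) simp
    then show "?I (A \<union> B) \<subseteq> Idl\<^bsub>mpoly_ring\<^esub> (?I A \<union> ?I B)"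
      using self[of A] self[of B] genideal_self[of "?I A \<union> ?I B"]
      by (intro genideal_minimal) auto
  qed
  then show ?thesis
    using union_genideal[OF ideal ideal] by metis
qed


section \<open>Hilbert functions of monomial ideals\<close>

lemma subfield_constants: "subfield constants (mpoly_ring :: ('n::finite, 'k::field) mpoly ring)"
proof -
  interpret cring "mpoly_ring :: ('n, 'k) mpoly ring"
    by (rule cring_mpoly_ring)
  have "subring constants (mpoly_ring :: ('n, 'k) mpoly ring)"
    by (rule subringI)
       (auto simp: constants_def single_uminus[symmetric] single_add[symmetric] mult_single
         simp flip: single_one)
  then have sub: "subcring constants (mpoly_ring :: ('n, 'k) mpoly ring)"
    by (rule subcringI) (simp add: mult.commute)
  have *: "Units (mpoly_ring\<lparr>carrier := constants :: ('n, 'k) mpoly set\<rparr>) = constants - {0}"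
  proof (intro equalityI subsetI)
    fix f :: "('n, 'k) mpoly"
    assume "f \<in> Units (mpoly_ring\<lparr>carrier := constants\<rparr>)"
    then show "f \<in> constants - {0}"
      by (auto simp: Units_def)
  next
    fix f :: "('n, 'k) mpoly"
    assume f: "f \<in> constants - {0}"
    then obtain c where c: "f = Poly_Mapping.single 0 c"
      by (auto simp: constants_def)
    with f have "c \<noteq> 0"
      by auto
    with c have "Poly_Mapping.single 0 (inverse c) * f = 1" "f * Poly_Mapping.single 0 (inverse c) = 1"
      by (simp_all add: mult_single)
    then show "f \<in> Units (mpoly_ring\<lparr>carrier := constants\<rparr>)"
      using c unfolding Units_def constants_def by auto
  qed
  show ?thesis
    by (rule subfieldI[OF sub]) (simp add: *)
qed

text \<open>
  The images in \<open>S/K\<close> of finitely many monomials outside \<open>K\<close> are linearly independent, and the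
  monomials inside \<open>K\<close> contribute nothing.  Allowing \<open>F\<close> to meet \<open>K\<close> makes the lemma apply
  directly to the set of all monomials of a given degree.  The monomials are added one at a time:
  a new one that lies in \<open>K\<close> leaves the image unchanged, and any other one extends it by a line.
\<close>

lemma dimension_image_monomial_span:
  fixes A :: "('n::finite \<Rightarrow>\<^sub>0 nat) set"
  defines "K \<equiv> monomial_span (exp_multiples A) :: ('n, 'k::field) mpoly set"
  assumes "finite F"
  shows "ring.dimension (mpoly_ring Quot K) (card (F - exp_multiples A))
    ((\<lambda>f. K +>\<^bsub>mpoly_ring\<^esub> f) ` constants) ((\<lambda>f. K +>\<^bsub>mpoly_ring\<^esub> f) ` monomial_span F)"
proof -
  interpret R: ring "mpoly_ring :: ('n, 'k) mpoly ring"
    by (rule ring_mpoly_ring)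
  interpret K: ideal K "mpoly_ring :: ('n, 'k) mpoly ring"
    unfolding K_def by (rule ideal_monomial_span)
  interpret Q: ring "mpoly_ring Quot K"
    by (rule K.quotient_is_ring)
  let ?\<pi> = "\<lambda>f. K +>\<^bsub>mpoly_ring\<^esub> f"
  interpret \<pi>: ring_hom_ring "mpoly_ring" "mpoly_ring Quot K" ?\<pi>
    by (rule K.rcos_ring_hom_ring)
  have eq_iff: "?\<pi> f = ?\<pi> g \<longleftrightarrow> f - g \<in> K" for f g
    using R.quotient_eq_iff_same_a_r_cos[OF K.ideal_axioms, of f g] by simp
  have comb: "?\<pi> (Poly_Mapping.single a c + g) =
      (?\<pi> (Poly_Mapping.single 0 c) \<otimes>\<^bsub>mpoly_ring Quot K\<^esub> ?\<pi> (monomial a))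
        \<oplus>\<^bsub>mpoly_ring Quot K\<^esub> ?\<pi> g" for a c g
    using \<pi>.hom_mult[of "Poly_Mapping.single 0 c" "monomial a"]
      \<pi>.hom_add[of "Poly_Mapping.single a c" g]
    by (simp add: single_eq_const_times_monomial[of a c])
  have image_insert: "?\<pi> ` monomial_span (insert a F) =
      {?\<pi> (Poly_Mapping.single a c + g) | c g. g \<in> monomial_span F}" for a F
  proof (rule Set.set_eqI)
    fix w
    show "w \<in> ?\<pi> ` monomial_span (insert a F) \<longleftrightarrow>
        w \<in> {?\<pi> (Poly_Mapping.single a c + g) | c g. g \<in> monomial_span F}"
      unfolding image_iff Bex_def monomial_span_insert_iff by blast
  qed
  show ?thesis
    using \<open>finite F\<close>
  proof (induction F)
    case empty
    have "?\<pi> ` monomial_span {} = {\<zero>\<^bsub>mpoly_ring Quot K\<^esub>}"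
      using \<pi>.hom_zero by (simp add: monomial_span_def)
    then show ?case
      using Q.zero_dim by simp
  next
    case (insert a F)
    show ?case
    proof (cases "a \<in> exp_multiples A")
      case True
      have "?\<pi> (Poly_Mapping.single a c + g) = ?\<pi> g" for c g
        unfolding eq_iff using True by (auto simp: K_def monomial_span_def split: if_splits)
      then have "?\<pi> ` monomial_span (insert a F) = ?\<pi> ` monomial_span F"
        unfolding image_insert by auto
      then show ?thesis
        using insert True by simp
    next
      case False
      have "?\<pi> ` monomial_span (insert a F) =
          Q.line_extension (?\<pi> ` constants) (?\<pi> (monomial a)) (?\<pi> ` monomial_span F)"
        unfolding image_insert
      proof (rule Set.set_eqI)
        fix w
        show "w \<in> {?\<pi> (Poly_Mapping.single a c + g) | c g. g \<in> monomial_span F} \<longleftrightarrow>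
            w \<in> Q.line_extension (?\<pi> ` constants) (?\<pi> (monomial a)) (?\<pi> ` monomial_span F)"
          unfolding comb Q.line_extension_mem_iff constants_def by blast
      qed
      moreover have "?\<pi> (monomial a) \<notin> ?\<pi> ` monomial_span F"
      proof
        assume "?\<pi> (monomial a) \<in> ?\<pi> ` monomial_span F"
        then obtain g where g: "g \<in> monomial_span F" "monomial a - g \<in> K"
          by (auto simp: eq_iff)
        \<comment> \<open>The coefficient of \<open>x\<^sup>a\<close> in \<open>x\<^sup>a - g\<close> is 1, so \<open>x\<^sup>a\<close> would be a monomial of an element of \<open>K\<close>.\<close>
        then have "Poly_Mapping.lookup g a = 0"
          using \<open>a \<notin> F\<close> by (auto simp: monomial_span_def in_keys_iff)
        then have "a \<in> Poly_Mapping.keys (monomial a - g)"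
          by (simp add: in_keys_iff lookup_minus monomial_def)
        with g(2) False show False
          by (auto simp: K_def monomial_span_def)
      qed
      moreover have "card (insert a F - exp_multiples A) = Suc (card (F - exp_multiples A))"
        using insert.hyps False by (simp add: insert_Diff_if)
      ultimately show ?thesis
        using Q.Suc_dim[OF _ _ insert.IH, of "?\<pi> (monomial a)"] \<pi>.hom_closed[of "monomial a"] by simp
    qed
  qed
qed

lemma finite_exp_le: "finite {b. exp_le b a}"
  and card_exp_le: "card {b. exp_le b a} = (\<Prod>i\<in>UNIV. Poly_Mapping.lookup a i + 1)"
proof -
  have bij: "bij_betw Poly_Mapping.lookup {b. exp_le b a} (\<Pi>\<^sub>E i\<in>UNIV. {..Poly_Mapping.lookup a i})"
  proof (rule bij_betw_imageI)
    show "inj_on Poly_Mapping.lookup {b. exp_le b a}"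
      by (intro inj_onI poly_mapping_eqI) simp
    show "Poly_Mapping.lookup ` {b. exp_le b a} = (\<Pi>\<^sub>E i\<in>UNIV. {..Poly_Mapping.lookup a i})"
    proof (intro equalityI subsetI)
      fix h assume "h \<in> (\<Pi>\<^sub>E i\<in>UNIV. {..Poly_Mapping.lookup a i})"
      moreover have "Poly_Mapping.lookup (Poly_Mapping.Abs_poly_mapping h) = h"
        by (rule lookup_Abs_poly_mapping) simp
      ultimately show "h \<in> Poly_Mapping.lookup ` {b. exp_le b a}"
        by (intro image_eqI[of _ _ "Poly_Mapping.Abs_poly_mapping h"])
           (simp_all add: exp_le_def PiE_iff)
    qed (auto simp: exp_le_def)
  qed
  then show "finite {b. exp_le b a}"
    by (simp add: bij_betw_finite finite_PiE)
  show "card {b. exp_le b a} = (\<Prod>i\<in>UNIV. Poly_Mapping.lookup a i + 1)"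
    using bij_betw_same_card[OF bij] by (simp add: card_PiE)
qed

lemma tdeg_mono: "exp_le b a \<Longrightarrow> tdeg b \<le> tdeg a"
  unfolding tdeg_def exp_le_def by (rule sum_mono) simp

lemma finite_tdeg_le: "finite {a :: 'n::finite \<Rightarrow>\<^sub>0 nat. tdeg a \<le> d}"
proof -
  define c where "c = Poly_Mapping.Abs_poly_mapping (\<lambda>_ :: 'n. d)"
  have c: "Poly_Mapping.lookup c i = d" for i
    unfolding c_def by (subst lookup_Abs_poly_mapping) simp_all
  have "exp_le a c" if "tdeg a \<le> d" for a
    unfolding exp_le_def c
  proof
    fix i
    have "Poly_Mapping.lookup a i \<le> tdeg a"
      unfolding tdeg_def by (rule member_le_sum) simp_all
    with that show "Poly_Mapping.lookup a i \<le> d"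
      by simp
  qed
  then have "{a. tdeg a \<le> d} \<subseteq> {b. exp_le b c}"
    by auto
  then show ?thesis
    using finite_exp_le by (rule finite_subset)
qed

lemma finite_tdeg_eq: "finite {a :: 'n::finite \<Rightarrow>\<^sub>0 nat. tdeg a = d}"
  by (rule finite_subset[OF _ finite_tdeg_le[of d]]) auto

text \<open>
  The hypothesis says that \<open>1\<close> is not a generator.  It makes the ideal proper, so that the constants
  remain a subfield of the quotient and dimension over them is well defined.
\<close>

theorem hilbert_function_genideal_monomials:
  fixes A :: "('n::finite \<Rightarrow>\<^sub>0 nat) set"
  assumes "0 \<notin> A"
  shows "hilbert_function (Idl\<^bsub>mpoly_ring\<^esub> (monomial ` A :: ('n, 'k::field) mpoly set)) d =
    card {a. tdeg a = d \<and> (\<forall>b\<in>A. \<not> exp_le b a)}"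
proof -
  define K where "K = (monomial_span (exp_multiples A) :: ('n, 'k) mpoly set)"
  interpret R: ring "mpoly_ring :: ('n, 'k) mpoly ring"
    by (rule ring_mpoly_ring)
  interpret K: ideal K "mpoly_ring :: ('n, 'k) mpoly ring"
    unfolding K_def by (rule ideal_monomial_span)
  interpret Q: ring "mpoly_ring Quot K"
    by (rule K.quotient_is_ring)
  let ?\<pi> = "\<lambda>f. K +>\<^bsub>mpoly_ring\<^esub> f"
  interpret \<pi>: ring_hom_ring "mpoly_ring" "mpoly_ring Quot K" ?\<pi>
    by (rule K.rcos_ring_hom_ring)
  have "(0 :: 'n \<Rightarrow>\<^sub>0 nat) \<notin> exp_multiples A"
  proof
    assume "(0 :: 'n \<Rightarrow>\<^sub>0 nat) \<in> exp_multiples A"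
    then obtain b where "b \<in> A" "exp_le b 0"
      by (auto simp: exp_multiples_def)
    moreover from this have "b = 0"
      by (intro poly_mapping_eqI) (simp add: exp_le_def)
    ultimately show False
      using assms by simp
  qed
  then have "1 \<notin> K"
    by (simp add: K_def monomial_span_def)
  then have "?\<pi> 1 \<noteq> ?\<pi> 0"
    using R.quotient_eq_iff_same_a_r_cos[OF K.ideal_axioms, of 1 0] by simp
  then have "\<one>\<^bsub>mpoly_ring Quot K\<^esub> \<noteq> \<zero>\<^bsub>mpoly_ring Quot K\<^esub>"
    using \<pi>.hom_one \<pi>.hom_zero by simp
  from \<pi>.img_is_subfield(2)[OF subfield_constants this]
  have "subfield (?\<pi> ` constants) (mpoly_ring Quot K)" .
  moreover have "homogeneous_part d = (monomial_span {a. tdeg a = d} :: ('n, 'k) mpoly set)"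
    by (auto simp: homogeneous_part_def monomial_span_def)
  moreover have "{a. tdeg a = d} - exp_multiples A = {a. tdeg a = d \<and> (\<forall>b\<in>A. \<not> exp_le b a)}"
    by (auto simp: exp_multiples_def)
  ultimately show ?thesis
    using Q.dimI dimension_image_monomial_span[OF finite_tdeg_eq[of d], of A, where 'k = 'k]
    unfolding hilbert_function_def genideal_monomials over_def K_def by simp
qed

lemma exp_le_single_iff:
  "exp_le (Poly_Mapping.single i k) a \<longleftrightarrow> k \<le> Poly_Mapping.lookup a i"
  by (auto simp: exp_le_def lookup_single when_def)

lemma pure_power_ideal_eq:
  "pure_power_ideal e = Idl\<^bsub>mpoly_ring\<^esub>
    (monomial ` range (\<lambda>i. Poly_Mapping.single i (e i)) :: ('n::finite, 'k::field) mpoly set)"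
  by (simp add: pure_power_ideal_def image_image)

lemma monomial_in_pure_power_ideal_iff:
  "(monomial a :: ('n::finite, 'k::field) mpoly) \<in> pure_power_ideal e \<longleftrightarrow>
    (\<exists>i. e i \<le> Poly_Mapping.lookup a i)"
  by (simp add: pure_power_ideal_eq genideal_monomials exp_multiples_def exp_le_single_iff)

lemma zero_notin_pure_powers:
  "(0 :: 'n \<Rightarrow>\<^sub>0 nat) \<notin> range (\<lambda>i. Poly_Mapping.single i (e i + 1))"
proof
  assume "(0 :: 'n \<Rightarrow>\<^sub>0 nat) \<in> range (\<lambda>i. Poly_Mapping.single i (e i + 1))"
  then obtain i where i: "(0 :: 'n \<Rightarrow>\<^sub>0 nat) = Poly_Mapping.single i (e i + 1)"
    by blast
  show False
    using lookup_single_eq[of i "e i + 1"] unfolding i[symmetric] by simp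
qed

lemma hilbert_function_divisor_ideal:
  fixes a :: "'n::finite \<Rightarrow>\<^sub>0 nat"
  shows "hilbert_function
      (pure_power_ideal (\<lambda>i. Poly_Mapping.lookup a i + 1) :: ('n, 'k::field) mpoly set) j =
    card {b. exp_le b a \<and> tdeg b = j}"
proof -
  have "(\<forall>c\<in>range (\<lambda>i. Poly_Mapping.single i (Poly_Mapping.lookup a i + 1)). \<not> exp_le c b) \<longleftrightarrow>
      exp_le b a" for b
    by (simp add: exp_le_single_iff not_less_eq_eq) (simp add: exp_le_def)
  then have "{b. tdeg b = j \<and> (\<forall>c\<in>range (\<lambda>i. Poly_Mapping.single i (Poly_Mapping.lookup a i + 1)).
      \<not> exp_le c b)} = {b. exp_le b a \<and> tdeg b = j}"
    by auto
  then show ?thesis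
    unfolding pure_power_ideal_eq
      hilbert_function_genideal_monomials[OF zero_notin_pure_powers] by simp
qed


section \<open>The random ideal\<close>

text \<open>
  Besides the candidate generators, the divisors of \<open>x\<^sup>a\<close> are \<open>1\<close> and those of degree above \<open>D\<close>;
  since a divisor has degree at most \<open>|a|\<close>, sorting the latter by degree gives the sum.
\<close>

lemma card_generators_dividing:
  fixes a :: "'n::finite \<Rightarrow>\<^sub>0 nat"
  shows "int (card {b. b \<noteq> 0 \<and> tdeg b \<le> D \<and> exp_le b a}) =
    int (\<Prod>i\<in>UNIV. Poly_Mapping.lookup a i + 1)
      - (\<Sum>j = D + 1..tdeg a. int (card {b. exp_le b a \<and> tdeg b = j})) - 1"
proof -
  define V where "V = {b. b \<noteq> 0 \<and> tdeg b \<le> D \<and> exp_le b a}"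
  define W where "W = (\<Union>j\<in>{D + 1..tdeg a}. {b. exp_le b a \<and> tdeg b = j})"
  have fin: "finite {b. exp_le b a \<and> P b}" for P
    by (rule finite_subset[OF _ finite_exp_le[of a]]) auto
  have "finite V"
    unfolding V_def by (rule finite_subset[OF _ finite_exp_le[of a]]) auto
  have "finite W"
    using fin by (simp add: W_def)
  have "exp_le b a \<longleftrightarrow> b = 0 \<or> b \<in> V \<or> b \<in> W" for b
    using tdeg_mono[of b a] by (auto simp: V_def W_def) (simp add: exp_le_def)
  then have "{b. exp_le b a} = insert 0 (V \<union> W)"
    by auto
  moreover have "0 \<notin> V \<union> W"
    by (simp add: V_def W_def tdeg_def)
  ultimately have "card {b. exp_le b a} = Suc (card (V \<union> W))"
    using \<open>finite V\<close> \<open>finite W\<close> by simp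
  also have "card (V \<union> W) = card V + card W"
    using \<open>finite V\<close> \<open>finite W\<close> by (intro card_Un_disjoint) (auto simp: V_def W_def)
  also have "card W = (\<Sum>j = D + 1..tdeg a. card {b. exp_le b a \<and> tdeg b = j})"
    unfolding W_def using fin by (intro card_UN_disjoint) auto
  finally show ?thesis
    unfolding card_exp_le V_def by simp
qed

lemma prob_Pi_bernoulli_avoids:
  assumes "finite G" "Y \<subseteq> G" "0 \<le> p" "p \<le> 1"
  shows "measure_pmf.prob (Pi_pmf G False (\<lambda>_. bernoulli_pmf p)) {h. \<forall>x\<in>Y. \<not> h x} =
    (1 - p) ^ card Y"
proof -
  have "{h. \<forall>x\<in>Y. \<not> h x} = Pi G (\<lambda>x. if x \<in> Y then {False} else UNIV)"
    using assms(2) by (fastforce simp: Pi_iff split: if_splits)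
  then have "measure_pmf.prob (Pi_pmf G False (\<lambda>_. bernoulli_pmf p)) {h. \<forall>x\<in>Y. \<not> h x} =
      (\<Prod>x\<in>G. if x \<in> Y then 1 - p else 1)"
    using assms by (simp add: measure_Pi_pmf_Pi if_distrib measure_pmf_single cong: if_cong)
  also have "\<dots> = (\<Prod>x\<in>G \<inter> Y. 1 - p)"
    using prod.inter_restrict[OF assms(1), of "\<lambda>_. 1 - p" Y] by simp
  also have "G \<inter> Y = Y"
    using assms(2) by blast
  finally show ?thesis
    by simp
qed

theorem corollary3p5:
  fixes D d :: nat and p q :: real
    and J :: "('n::finite, 'k::field) mpoly set"
  assumes "infinite (UNIV :: 'k set)"
    and "D \<ge> 1"
    and "0 \<le> p" and "p < 1"
    and "q = 1 - p"
    and "J = pure_power_ideal (\<lambda>i. D + 1)"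
  shows "measure_pmf.expectation
           (ER_monomial_ideal_pmf D p :: ('n, 'k) mpoly set pmf)
           (\<lambda>I. real (hilbert_function (I <+>\<^bsub>mpoly_ring\<^esub> J) d))
         = inverse q *
           (\<Sum>a | monomial a \<in> homogeneous_part d - J.
              q powi (int (\<Prod>i\<in>UNIV. Poly_Mapping.lookup a i + 1)
                      - (\<Sum>j = D + 1..tdeg a.
                          int (hilbert_function
                            (pure_power_ideal (\<lambda>i. Poly_Mapping.lookup a i + 1)
                              :: ('n, 'k) mpoly set) j))))"
proof -
  define G where "G = {b :: 'n \<Rightarrow>\<^sub>0 nat. b \<noteq> 0 \<and> tdeg b \<le> D}"
  define M where "M = (monomial :: _ \<Rightarrow> ('n, 'k) mpoly)"
  define S where "S = {a :: 'n \<Rightarrow>\<^sub>0 nat. monomial a \<in> homogeneous_part d - J}"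
  define Y where "Y = (\<lambda>a. {b \<in> G. exp_le b a})"
  \<comment> \<open>The event that no chosen generator divides \<open>x\<^sup>a\<close>.\<close>
  define E where "E = (\<lambda>a. {h. \<forall>x\<in>M ` Y a. \<not> h x})"
  let ?P = "Pi_pmf (M ` G) False (\<lambda>_. bernoulli_pmf p)"
  have inj: "inj M"
    by (rule injI) (metis M_def monomial_def keys_single singleton_inject zero_neq_one)
  have "finite G"
    unfolding G_def by (rule finite_subset[OF _ finite_tdeg_le[of D]]) auto
  have "(monomial a :: ('n, 'k) mpoly) \<in> homogeneous_part d \<longleftrightarrow> tdeg a = d" for a
    by (simp add: homogeneous_part_def monomial_def)
  then have S_eq: "S = {a. tdeg a = d \<and> (\<forall>i. Poly_Mapping.lookup a i \<le> D)}"
    by (auto simp: S_def assms(6) monomial_in_pure_power_ideal_iff not_less_eq_eq)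
  have "finite S"
    unfolding S_eq by (rule finite_subset[OF _ finite_tdeg_eq[of d]]) auto
  \<comment> \<open>Here \<open>h\<close> is an outcome: it tells which of the candidate generators were chosen.\<close>
  have hilbert: "real (hilbert_function (Idl\<^bsub>mpoly_ring\<^esub> {x \<in> M ` G. h x} <+>\<^bsub>mpoly_ring\<^esub> J) d) =
      (\<Sum>a\<in>S. indicator (E a) h)" for h
  proof -
    let ?B = "{b \<in> G. h (M b)}"
    let ?C = "range (\<lambda>i. Poly_Mapping.single i (D + 1)) :: ('n \<Rightarrow>\<^sub>0 nat) set"
    have "{x \<in> M ` G. h x} = M ` ?B"
      by auto
    then have "Idl\<^bsub>mpoly_ring\<^esub> {x \<in> M ` G. h x} <+>\<^bsub>mpoly_ring\<^esub> J =
        Idl\<^bsub>mpoly_ring\<^esub> (monomial ` (?B \<union> ?C) :: ('n, 'k) mpoly set)"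
      unfolding assms(6) pure_power_ideal_eq M_def by (simp only: sum_genideal_monomials)
    moreover have "0 \<notin> ?B \<union> ?C"
      using zero_notin_pure_powers[of "\<lambda>_. D"] by (simp add: G_def)
    ultimately have "hilbert_function (Idl\<^bsub>mpoly_ring\<^esub> {x \<in> M ` G. h x} <+>\<^bsub>mpoly_ring\<^esub> J) d =
        card {a. tdeg a = d \<and> (\<forall>b\<in>?B \<union> ?C. \<not> exp_le b a)}"
      by (simp only: hilbert_function_genideal_monomials not_False_eq_True)
    also have "{a. tdeg a = d \<and> (\<forall>b\<in>?B \<union> ?C. \<not> exp_le b a)} = {a\<in>S. h \<in> E a}"
    proof -
      have C: "(\<forall>b\<in>?C. \<not> exp_le b a) \<longleftrightarrow> (\<forall>i. Poly_Mapping.lookup a i \<le> D)" for a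
        by (simp add: exp_le_single_iff not_less_eq_eq)
      show ?thesis
        unfolding ball_Un C by (auto simp: S_eq E_def Y_def)
    qed
    finally show ?thesis
      using \<open>finite S\<close> by (simp add: indicator_def sum.If_cases Int_def)
  qed
  have prob: "measure_pmf.prob ?P (E a) = inverse q *
      q powi (int (\<Prod>i\<in>UNIV. Poly_Mapping.lookup a i + 1)
        - (\<Sum>j = D + 1..tdeg a. int (hilbert_function
            (pure_power_ideal (\<lambda>i. Poly_Mapping.lookup a i + 1) :: ('n, 'k) mpoly set) j)))" for a
  proof -
    have "measure_pmf.prob ?P (E a) = q ^ card (M ` Y a)"
      unfolding E_def assms(5) using \<open>finite G\<close> assms(3,4)
      by (intro prob_Pi_bernoulli_avoids) (auto simp: Y_def)
    also have "card (M ` Y a) = card (Y a)"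
      using inj by (intro card_image) (auto intro: inj_on_subset)
    also have "q ^ card (Y a) = q powi int (card (Y a))"
      by simp
    also have "Y a = {b. b \<noteq> 0 \<and> tdeg b \<le> D \<and> exp_le b a}"
      by (auto simp: Y_def G_def)
    also have "q powi int (card \<dots>) = inverse q * q powi (int (\<Prod>i\<in>UNIV. Poly_Mapping.lookup a i + 1)
        - (\<Sum>j = D + 1..tdeg a. int (card {b. exp_le b a \<and> tdeg b = j})))"
      unfolding card_generators_dividing using assms(4,5)
      by (subst power_int_diff) (auto simp: field_simps)
    finally show ?thesis
      by (simp only: hilbert_function_divisor_ideal)
  qed
  have "measure_pmf.expectation (ER_monomial_ideal_pmf D p :: ('n, 'k) mpoly set pmf)
      (\<lambda>I. real (hilbert_function (I <+>\<^bsub>mpoly_ring\<^esub> J) d)) =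
      measure_pmf.expectation ?P (\<lambda>h. \<Sum>a\<in>S. indicator (E a) h)"
    unfolding ER_monomial_ideal_pmf_def random_subset_pmf_def
    by (simp only: integral_map_pmf G_def[symmetric] M_def[symmetric] hilbert)
  also have "\<dots> = (\<Sum>a\<in>S. measure_pmf.prob ?P (E a))"
    by (subst Bochner_Integration.integral_sum) (auto intro!: integrable_real_indicator simp: less_top[symmetric])
  finally show ?thesis
    by (simp only: prob S_def sum_distrib_left)
qed

end
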